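(* Let $M$ be a transversal matroid of rank $r$ and $\mathcal{A}$ a presentation of $M$. For any $I,J\in L_\mathcal{A}$, we have $M[\mathcal{A}^I]\leq_w M[\mathcal{A}^J]$ if and only if $I\subseteq J$. Consequently the bijection $I\mapsto M[\mathcal{A}^I]$ from $L_\mathcal{A}$ onto $T_\mathcal{A}$ is a lattice isomorphism, and $T_\mathcal{A}$ is a distributive lattice.
   Context: $[r]=\{1,\dots,r\}$. For a set system $\mathcal{A}=(A_i:i\in[r])$ on a finite set $E$, $M[\mathcal{A}]$ is the transversal matroid on $E$ whose independent sets are the partial transversals of $\mathcal{A}$ (sets $X\subseteq E$ admitting an injection $\phi:X\to[r]$ with $e\in A_{\phi(e)}$); $\mathcal{A}$ is a presentation of $M[\mathcal{A}]$, and presentations of a rank-$r$ matroid are taken to have exactly $r$ sets. Fix $x\notin E$; for $I\subseteq[r]$, $\mathcal{A}^I$ is obtained from $\mathcal{A}$ by replacing $A_i$ by $A_i\cup\{x\}$ for each $i\in I$. Let $\sigma_\mathcal{A}(I)=I\cup\{k\in[r]-I: x\text{ is a coloop of } M[\mathcal{A}^I]\backslash A_k\}$; $L_\mathcal{A}$ is the lattice (under inclusion) of sets $I\subseteq[r]$ with $\sigma_\mathcal{A}(I)=I$. $T_\mathcal{A}=\{M[\mathcal{A}^I]: I\in L_\mathcal{A}\}$ (equivalently, all $M[\mathcal{A}^I]$ with $I\subseteq[r]$), ordered by the weak order: for matroids $N_1,N_2$ on the same set, $N_1\leq_w N_2$ if every independent set of $N_1$ is independent in $N_2$. *)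

theory Defs
  imports "HOL-Library.FuncSet" "HOL-Algebra.Lattice"
begin

record 'a matroid =
  ground :: "'a set"
  indep :: "'a set set"

definition is_matroid :: "'a matroid \<Rightarrow> bool" where
  "is_matroid M \<longleftrightarrow>
     finite (ground M) \<and> indep M \<subseteq> Pow (ground M) \<and> {} \<in> indep M \<and>
     (\<forall>X\<in>indep M. \<forall>Y\<subseteq>X. Y \<in> indep M) \<and>
     (\<forall>X\<in>indep M. \<forall>Y\<in>indep M. card X < card Y \<longrightarrow> (\<exists>y\<in>Y - X. insert y X \<in> indep M))"

definition basis :: "'a matroid \<Rightarrow> 'a set \<Rightarrow> bool" where
  "basis M B \<longleftrightarrow> B \<in> indep M \<and> (\<forall>X\<in>indep M. B \<subseteq> X \<longrightarrow> X = B)"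

definition matroid_rank :: "'a matroid \<Rightarrow> nat" where
  "matroid_rank M = Max (card ` indep M)"

definition matroid_delete :: "'a matroid \<Rightarrow> 'a set \<Rightarrow> 'a matroid" where
  "matroid_delete M D = \<lparr>ground = ground M - D, indep = {X \<in> indep M. X \<inter> D = {}}\<rparr>"

definition coloop :: "'a matroid \<Rightarrow> 'a \<Rightarrow> bool" where
  "coloop M e \<longleftrightarrow> e \<in> ground M \<and> (\<forall>B. basis M B \<longrightarrow> e \<in> B)"

definition weak_le :: "'a matroid \<Rightarrow> 'a matroid \<Rightarrow> bool" where
  "weak_le N1 N2 \<longleftrightarrow> ground N1 = ground N2 \<and> indep N1 \<subseteq> indep N2"

text \<open>A set system with \<open>r\<close> sets is a function \<open>A\<close> on \<open>nat\<close> of which only the values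
  on \<open>{1..r}\<close> matter.\<close>

definition partial_transversal :: "nat \<Rightarrow> (nat \<Rightarrow> 'a set) \<Rightarrow> 'a set \<Rightarrow> bool" where
  "partial_transversal r A X \<longleftrightarrow>
     (\<exists>\<phi>. \<phi> \<in> X \<rightarrow> {1..r} \<and> inj_on \<phi> X \<and> (\<forall>e\<in>X. e \<in> A (\<phi> e)))"

definition transversal_matroid_of :: "'a set \<Rightarrow> nat \<Rightarrow> (nat \<Rightarrow> 'a set) \<Rightarrow> 'a matroid" where
  "transversal_matroid_of E r A = \<lparr>ground = E, indep = {X. X \<subseteq> E \<and> partial_transversal r A X}\<rparr>"

definition is_transversal :: "'a matroid \<Rightarrow> bool" where
  "is_transversal M \<longleftrightarrow> is_matroid M \<and>
     (\<exists>r A. (\<forall>i\<in>{1..r}. A i \<subseteq> ground M) \<and> M = transversal_matroid_of (ground M) r A)"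

definition is_presentation :: "nat \<Rightarrow> (nat \<Rightarrow> 'a set) \<Rightarrow> 'a matroid \<Rightarrow> bool" where
  "is_presentation r A M \<longleftrightarrow>
     matroid_rank M = r \<and> (\<forall>i\<in>{1..r}. A i \<subseteq> ground M) \<and>
     M = transversal_matroid_of (ground M) r A"

definition extend_system :: "(nat \<Rightarrow> 'a set) \<Rightarrow> 'a \<Rightarrow> nat set \<Rightarrow> nat \<Rightarrow> 'a set" where
  "extend_system A x I i = (if i \<in> I then A i \<union> {x} else A i)"

definition ext_matroid :: "'a set \<Rightarrow> nat \<Rightarrow> (nat \<Rightarrow> 'a set) \<Rightarrow> 'a \<Rightarrow> nat set \<Rightarrow> 'a matroid" where
  "ext_matroid E r A x I = transversal_matroid_of (E \<union> {x}) r (extend_system A x I)"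

definition sigma_op :: "'a set \<Rightarrow> nat \<Rightarrow> (nat \<Rightarrow> 'a set) \<Rightarrow> 'a \<Rightarrow> nat set \<Rightarrow> nat set" where
  "sigma_op E r A x I =
     I \<union> {k \<in> {1..r} - I. coloop (matroid_delete (ext_matroid E r A x I) (A k)) x}"

definition L_set :: "'a set \<Rightarrow> nat \<Rightarrow> (nat \<Rightarrow> 'a set) \<Rightarrow> 'a \<Rightarrow> nat set set" where
  "L_set E r A x = {I. I \<subseteq> {1..r} \<and> sigma_op E r A x I = I}"

definition T_set :: "'a set \<Rightarrow> nat \<Rightarrow> (nat \<Rightarrow> 'a set) \<Rightarrow> 'a \<Rightarrow> 'a matroid set" where
  "T_set E r A x = ext_matroid E r A x ` L_set E r A x"

definition L_order :: "'a set \<Rightarrow> nat \<Rightarrow> (nat \<Rightarrow> 'a set) \<Rightarrow> 'a \<Rightarrow> nat set gorder" where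
  "L_order E r A x = \<lparr>carrier = L_set E r A x, eq = (=), le = (\<subseteq>)\<rparr>"

definition T_order :: "'a set \<Rightarrow> nat \<Rightarrow> (nat \<Rightarrow> 'a set) \<Rightarrow> 'a \<Rightarrow> 'a matroid gorder" where
  "T_order E r A x = \<lparr>carrier = T_set E r A x, eq = (=), le = weak_le\<rparr>"

definition lattice_iso :: "'a gorder \<Rightarrow> 'b gorder \<Rightarrow> ('a \<Rightarrow> 'b) \<Rightarrow> bool" where
  "lattice_iso L K h \<longleftrightarrow>
     lattice L \<and> lattice K \<and> bij_betw h (carrier L) (carrier K) \<and>
     (\<forall>a\<in>carrier L. \<forall>b\<in>carrier L.
        h (a \<squnion>\<^bsub>L\<^esub> b) = h a \<squnion>\<^bsub>K\<^esub> h b \<and> h (a \<sqinter>\<^bsub>L\<^esub> b) = h a \<sqinter>\<^bsub>K\<^esub> h b)"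

definition distributive_lattice :: "'a gorder \<Rightarrow> bool" where
  "distributive_lattice L \<longleftrightarrow>
     lattice L \<and>
     (\<forall>a\<in>carrier L. \<forall>b\<in>carrier L. \<forall>c\<in>carrier L.
        a \<sqinter>\<^bsub>L\<^esub> (b \<squnion>\<^bsub>L\<^esub> c) = (a \<sqinter>\<^bsub>L\<^esub> b) \<squnion>\<^bsub>L\<^esub> (a \<sqinter>\<^bsub>L\<^esub> c))"

lemma matching_augment:
  assumes "finite X" "finite Y" "card X < card Y"
    and g: "g \<in> Y \<rightarrow> {1..r}" "inj_on g Y" "\<forall>e\<in>Y. e \<in> A (g e)"
    and f: "f \<in> X \<rightarrow> {1..r}" "inj_on f X" "\<forall>e\<in>X. e \<in> A (f e)"
  shows "\<exists>y\<in>Y - X. partial_transversal r A (insert y X)"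
  using f
proof (induction "card {e \<in> X \<inter> Y. f e \<noteq> g e}" arbitrary: f rule: less_induct)
  case less
  have "card (f ` X) < card (g ` Y)"
    using assms(3) g(2) less.prems(2) by (simp add: card_image)
  hence "\<not> g ` Y \<subseteq> f ` X"
    using assms(1) by (meson card_mono finite_imageI not_less)
  then obtain y where y: "y \<in> Y" "g y \<notin> f ` X" by blast
  let ?f = "f(y := g y)"
  have ne: "f e \<noteq> g y" "g y \<noteq> f e" if "e \<in> X" for e
    using y(2) that by (metis imageI)+
  have inj: "inj_on ?f (insert y X)"
  proof (rule inj_onI)
    fix a b
    assume "a \<in> insert y X" "b \<in> insert y X" "?f a = ?f b"
    thus "a = b"
      using inj_onD[OF less.prems(2), of a b] ne by (auto split: if_splits)
  qed
  have ran: "?f \<in> insert y X \<rightarrow> {1..r}"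
    using less.prems(1) g(1) y(1) by (auto simp: Pi_iff)
  have mem: "\<forall>e\<in>insert y X. e \<in> A (?f e)"
    using less.prems(3) g(3) y(1) by auto
  show ?case
  proof (cases "y \<in> X")
    case False
    then show ?thesis
      using y(1) inj ran mem unfolding partial_transversal_def by blast
  next
    case True
    have "{e \<in> X \<inter> Y. ?f e \<noteq> g e} \<subset> {e \<in> X \<inter> Y. f e \<noteq> g e}"
    proof (rule psubsetI)
      show "{e \<in> X \<inter> Y. ?f e \<noteq> g e} \<subseteq> {e \<in> X \<inter> Y. f e \<noteq> g e}"
        by (auto split: if_splits)
      have "f y \<noteq> g y" using True y(2) by (metis imageI)
      hence "y \<in> {e \<in> X \<inter> Y. f e \<noteq> g e}" "y \<notin> {e \<in> X \<inter> Y. ?f e \<noteq> g e}"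
        using True y(1) by simp_all
      thus "{e \<in> X \<inter> Y. ?f e \<noteq> g e} \<noteq> {e \<in> X \<inter> Y. f e \<noteq> g e}" by metis
    qed
    hence "card {e \<in> X \<inter> Y. ?f e \<noteq> g e} < card {e \<in> X \<inter> Y. f e \<noteq> g e}"
      using assms(1) by (intro psubset_card_mono) auto
    moreover have "insert y X = X" using True by blast
    ultimately show ?thesis
      using less.hyps[of ?f] inj ran mem by simp
  qed
qed

lemma is_matroid_transversal_matroid_of:
  assumes "finite E"
  shows "is_matroid (transversal_matroid_of E r A)"
proof -
  have sub: "partial_transversal r A Y" if "partial_transversal r A X" "Y \<subseteq> X" for X Y
  proof -
    from that(1) obtain f where "f \<in> X \<rightarrow> {1..r}" "inj_on f X" "\<forall>e\<in>X. e \<in> A (f e)"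
      unfolding partial_transversal_def by blast
    with that(2) have "f \<in> Y \<rightarrow> {1..r}" "inj_on f Y" "\<forall>e\<in>Y. e \<in> A (f e)"
      by (auto intro: inj_on_subset)
    thus ?thesis unfolding partial_transversal_def by blast
  qed
  have emp: "partial_transversal r A {}"
    by (simp add: partial_transversal_def)
  have aug: "\<exists>y\<in>Y - X. partial_transversal r A (insert y X)"
    if XY: "X \<subseteq> E" "Y \<subseteq> E" "partial_transversal r A X" "partial_transversal r A Y"
      "card X < card Y" for X Y
  proof -
    from XY(3) obtain f where f: "f \<in> X \<rightarrow> {1..r}" "inj_on f X" "\<forall>e\<in>X. e \<in> A (f e)"
      unfolding partial_transversal_def by blast
    from XY(4) obtain g where g: "g \<in> Y \<rightarrow> {1..r}" "inj_on g Y" "\<forall>e\<in>Y. e \<in> A (g e)"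
      unfolding partial_transversal_def by blast
    show ?thesis
      by (rule matching_augment[OF finite_subset[OF XY(1) assms] finite_subset[OF XY(2) assms]
            XY(5) g f])
  qed
  have "\<forall>X\<in>{X. X \<subseteq> E \<and> partial_transversal r A X}. \<forall>Y\<in>{X. X \<subseteq> E \<and> partial_transversal r A X}.
      card X < card Y \<longrightarrow> (\<exists>y\<in>Y - X. insert y X \<in> {X. X \<subseteq> E \<and> partial_transversal r A X})"
  proof (intro ballI impI)
    fix X Y
    assume X: "X \<in> {X. X \<subseteq> E \<and> partial_transversal r A X}"
      and Y: "Y \<in> {X. X \<subseteq> E \<and> partial_transversal r A X}" and c: "card X < card Y"
    obtain y where "y \<in> Y - X" "partial_transversal r A (insert y X)"
      using aug[of X Y] X Y c by blast
    thus "\<exists>y\<in>Y - X. insert y X \<in> {X. X \<subseteq> E \<and> partial_transversal r A X}"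
      using X Y by blast
  qed
  moreover have "\<forall>X\<in>{X. X \<subseteq> E \<and> partial_transversal r A X}. \<forall>Y\<subseteq>X.
      Y \<in> {X. X \<subseteq> E \<and> partial_transversal r A X}"
    using sub by blast
  ultimately show ?thesis
    unfolding is_matroid_def transversal_matroid_of_def matroid.simps
    using assms emp by blast
qed

end

theory Submission imports Defs begin

text \<open>
  Call \<open>C \<subseteq> [r]\<close> tight if some \<open>X \<subseteq> E\<close> is matched bijectively onto \<open>C\<close> and meets no \<open>A\<^sub>i\<close> with
  \<open>i \<notin> C\<close>. If a matching of an independent set \<open>X\<close> misses \<open>k\<close>, alternating paths from the missed
  indices yield a tight set \<open>C\<close> with \<open>k \<notin> C\<close> such that every index outside \<open>C\<close> is missed by some
  matching of \<open>X\<close>. Hence \<open>k \<notin> \<sigma>(I)\<close> iff some tight \<open>C \<supseteq> I\<close> omits \<open>k\<close>, and \<open>\<sigma>(I)\<close> is the largest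
  \<open>J\<close> with \<open>M[\<A>\<^sup>J] \<le>\<^sub>w M[\<A>\<^sup>I]\<close>. Tight sets are closed under unions, so the members of
  \<open>L\<^sub>\<A>\<close>, being the intersections of tight sets, form a ring of sets.
\<close>

section \<open>Matchings and tight sets\<close>

definition matching :: "nat \<Rightarrow> (nat \<Rightarrow> 'a set) \<Rightarrow> 'a set \<Rightarrow> ('a \<Rightarrow> nat) \<Rightarrow> bool" where
  "matching r A X \<phi> \<longleftrightarrow> \<phi> \<in> X \<rightarrow> {1..r} \<and> inj_on \<phi> X \<and> (\<forall>e\<in>X. e \<in> A (\<phi> e))"

text \<open>In Hall's terms, \<open>C\<close> is the neighbourhood of \<open>X\<close> in
  \<open>{1..r}\<close>, and equality holds in Hall's condition for \<open>X\<close>.\<close>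

definition tight :: "'a set \<Rightarrow> nat \<Rightarrow> (nat \<Rightarrow> 'a set) \<Rightarrow> nat set \<Rightarrow> bool" where
  "tight E r A C \<longleftrightarrow> C \<subseteq> {1..r} \<and>
     (\<exists>X \<phi>. X \<subseteq> E \<and> bij_betw \<phi> X C \<and> (\<forall>e\<in>X. e \<in> A (\<phi> e)) \<and>
            (\<forall>e\<in>X. \<forall>i\<in>{1..r} - C. e \<notin> A i))"

lemma partial_transversal_iff_matching: "partial_transversal r A X \<longleftrightarrow> (\<exists>\<phi>. matching r A X \<phi>)"
  by (simp add: partial_transversal_def matching_def)

lemma matching_subset: "matching r A X \<phi> \<Longrightarrow> Y \<subseteq> X \<Longrightarrow> matching r A Y \<phi>"
  unfolding matching_def by (auto intro: inj_on_subset)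

text \<open>The element \<open>e\<close> may already lie in \<open>X\<close>; it then moves to
  \<open>i\<close> and gives up its old index.\<close>

lemma matching_update:
  assumes "matching r A X \<phi>" "i \<in> {1..r}" "i \<notin> \<phi> ` X" "e \<in> A i"
  shows "matching r A (insert e X) (\<phi>(e := i))"
proof -
  have "inj_on (\<phi>(e := i)) (insert e X)"
  proof (rule inj_onI)
    fix a b
    assume "a \<in> insert e X" "b \<in> insert e X" "(\<phi>(e := i)) a = (\<phi>(e := i)) b"
    with assms(1,3) show "a = b"
      unfolding matching_def by (auto split: if_splits dest: inj_onD)
  qed
  with assms show ?thesis
    unfolding matching_def by (auto simp: Pi_iff)
qed

text \<open>Keep the matching onto \<open>C\<close> and add the elements of \<open>Y\<close> matched
  outside \<open>C\<close>. These are not in \<open>X\<close>, since \<open>X\<close> meets no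
  \<open>A i\<close> with \<open>i\<close> outside \<open>C\<close>.\<close>

lemma tight_Un:
  assumes "tight E r A C" "tight E r A D"
  shows "tight E r A (C \<union> D)"
proof -
  obtain X \<phi> where X: "X \<subseteq> E" "bij_betw \<phi> X C" "\<forall>e\<in>X. e \<in> A (\<phi> e)"
      "\<forall>e\<in>X. \<forall>i\<in>{1..r} - C. e \<notin> A i"
    using assms(1) unfolding tight_def by blast
  obtain Y \<psi> where Y: "Y \<subseteq> E" "bij_betw \<psi> Y D" "\<forall>e\<in>Y. e \<in> A (\<psi> e)"
      "\<forall>e\<in>Y. \<forall>i\<in>{1..r} - D. e \<notin> A i"
    using assms(2) unfolding tight_def by blast
  have CD: "C \<subseteq> {1..r}" "D \<subseteq> {1..r}"
    using assms unfolding tight_def by auto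
  define Y' where "Y' = {y \<in> Y. \<psi> y \<notin> C}"
  define \<chi> where "\<chi> = (\<lambda>e. if e \<in> X then \<phi> e else \<psi> e)"
  have disj: "X \<inter> Y' = {}"
    using X(4) Y(2,3) CD unfolding Y'_def bij_betw_def by blast
  have "bij_betw \<chi> X C"
    using X(2) by (rule bij_betw_cong[THEN iffD1, rotated]) (simp add: \<chi>_def)
  moreover have "bij_betw \<psi> Y' (D - C)"
    using Y(2) unfolding bij_betw_def Y'_def by (auto intro: inj_on_subset)
  then have "bij_betw \<chi> Y' (D - C)"
    by (rule bij_betw_cong[THEN iffD1, rotated]) (use disj in \<open>auto simp: \<chi>_def\<close>)
  ultimately have "bij_betw \<chi> (X \<union> Y') (C \<union> (D - C))"
    by (rule bij_betw_combine) blast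
  then have "bij_betw \<chi> (X \<union> Y') (C \<union> D)"
    by simp
  moreover have "X \<union> Y' \<subseteq> E"
    using X(1) Y(1) by (auto simp: Y'_def)
  moreover have "\<forall>e\<in>X \<union> Y'. e \<in> A (\<chi> e)"
    using X(3) Y(3) by (auto simp: \<chi>_def Y'_def)
  moreover have "\<forall>e\<in>X \<union> Y'. \<forall>i\<in>{1..r} - (C \<union> D). e \<notin> A i"
    using X(4) Y(4) by (auto simp: Y'_def)
  ultimately show ?thesis
    using CD unfolding tight_def by blast
qed

text \<open>\<open>C\<close> is the complement of a maximal set \<open>K\<close> of indices that
  rematching can free; the elements of \<open>X\<close> that \<open>\<phi>\<close> sends outside
  \<open>K\<close> witness that \<open>C\<close> is tight.\<close>

lemma tight_of_missed_index:
  assumes "matching r A X \<phi>" "X \<subseteq> E" "k \<in> {1..r}" "k \<notin> \<phi> ` X"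
  obtains C where "tight E r A C" "k \<notin> C"
    "\<And>i. i \<in> {1..r} - C \<Longrightarrow> \<exists>\<psi>. matching r A X \<psi> \<and> i \<notin> \<psi> ` X"
proof -
  \<comment> \<open>The requirement that \<open>\<psi>\<close> agree with \<open>\<phi>\<close> on the elements matched outside \<open>K\<close> is what allows one
    to free a further index \<open>\<phi> e\<close> without controlling the alternating paths used so far.\<close>
  define good where "good K \<longleftrightarrow> {1..r} - \<phi> ` X \<subseteq> K \<and> K \<subseteq> {1..r} \<and>
      (\<forall>j\<in>K. \<exists>\<psi>. matching r A X \<psi> \<and> j \<notin> \<psi> ` X \<and> (\<forall>e\<in>X. \<phi> e \<notin> K \<longrightarrow> \<psi> e = \<phi> e))" for K
  have "good ({1..r} - \<phi> ` X)"
    using assms(1) unfolding good_def by blast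
  moreover have "finite {K. good K}"
    by (rule finite_subset[of _ "Pow {1..r}"]) (auto simp: good_def)
  ultimately obtain K where K: "good K" and max: "\<And>K'. good K' \<Longrightarrow> K \<subseteq> K' \<Longrightarrow> K' = K"
    using finite_has_maximal[of "{K. good K}"] by blast
  \<comment> \<open>Otherwise moving \<open>e\<close> to a freed index \<open>i\<close> would free
    \<open>\<phi> e\<close> as well, and \<open>K\<close> could grow.\<close>
  have closed: "\<phi> e \<in> K" if e: "e \<in> X" "i \<in> K" "e \<in> A i" for e i
  proof (rule ccontr)
    assume nK: "\<phi> e \<notin> K"
    obtain \<psi> where \<psi>: "matching r A X \<psi>" "i \<notin> \<psi> ` X" "\<forall>e\<in>X. \<phi> e \<notin> K \<longrightarrow> \<psi> e = \<phi> e"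
      using K e(2) unfolding good_def by blast
    have "i \<in> {1..r}"
      using K e(2) unfolding good_def by blast
    from matching_update[OF \<psi>(1) this \<psi>(2) e(3)]
    have "matching r A X (\<psi>(e := i))"
      using e(1) by (simp add: insert_absorb)
    moreover have "\<phi> e \<notin> (\<psi>(e := i)) ` X"
    proof
      assume "\<phi> e \<in> (\<psi>(e := i)) ` X"
      then obtain a where a: "a \<in> X" "\<phi> e = (if a = e then i else \<psi> a)"
        by auto
      have "a \<noteq> e"
        using a nK e(2) by auto
      with a have "\<psi> a = \<psi> e"
        using \<psi>(3) e(1) nK by simp
      with \<open>a \<noteq> e\<close> a(1) e(1) \<psi>(1) show False
        unfolding matching_def by (auto dest: inj_onD)
    qed
    moreover have "\<forall>a\<in>X. \<phi> a \<notin> insert (\<phi> e) K \<longrightarrow> (\<psi>(e := i)) a = \<phi> a"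
      using \<psi>(3) by auto
    ultimately have new: "\<exists>\<chi>. matching r A X \<chi> \<and> \<phi> e \<notin> \<chi> ` X \<and>
        (\<forall>a\<in>X. \<phi> a \<notin> insert (\<phi> e) K \<longrightarrow> \<chi> a = \<phi> a)"
      by blast
    \<comment> \<open>Enlarging \<open>K\<close> only weakens the agreement with
      \<open>\<phi>\<close>, so the matchings for the old indices still serve.\<close>
    have "\<exists>\<chi>. matching r A X \<chi> \<and> j \<notin> \<chi> ` X \<and>
        (\<forall>a\<in>X. \<phi> a \<notin> insert (\<phi> e) K \<longrightarrow> \<chi> a = \<phi> a)" if "j \<in> K" for j
      using K that unfolding good_def by (meson insertCI)
    moreover have "\<phi> e \<in> {1..r}"
      using assms(1) e(1) unfolding matching_def by blast
    moreover have "{1..r} - \<phi> ` X \<subseteq> K" "K \<subseteq> {1..r}"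
      using K unfolding good_def by auto
    ultimately have "good (insert (\<phi> e) K)"
      using new unfolding good_def by (intro conjI ballI) auto
    with max nK show False by blast
  qed
  have Ksub: "{1..r} - \<phi> ` X \<subseteq> K" "K \<subseteq> {1..r}"
    using K unfolding good_def by auto
  let ?Y = "{e \<in> X. \<phi> e \<notin> K}"
  \<comment> \<open>Surjective because every index missed by \<open>\<phi>\<close> lies in
    \<open>K\<close>.\<close>
  have "bij_betw \<phi> ?Y ({1..r} - K)"
    using assms(1) Ksub unfolding matching_def bij_betw_def by (auto intro: inj_on_subset)
  moreover have "\<forall>e\<in>?Y. e \<in> A (\<phi> e)"
    using assms(1) unfolding matching_def by blast
  moreover have "\<forall>e\<in>?Y. \<forall>i\<in>{1..r} - ({1..r} - K). e \<notin> A i"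
    using closed by blast
  moreover have "?Y \<subseteq> E"
    using assms(2) by blast
  ultimately have "tight E r A ({1..r} - K)"
    unfolding tight_def by blast
  moreover have "k \<notin> {1..r} - K"
    using assms(3,4) Ksub by blast
  moreover have "\<exists>\<psi>. matching r A X \<psi> \<and> i \<notin> \<psi> ` X" if "i \<in> {1..r} - ({1..r} - K)" for i
    using K that unfolding good_def by blast
  ultimately show thesis
    by (rule that)
qed

section \<open>Independent sets of the extensions by \<open>x\<close>\<close>

lemma indep_ext_matroid:
  "X \<in> indep (ext_matroid E r A x I) \<longleftrightarrow>
     X \<subseteq> insert x E \<and> (\<exists>\<phi>. matching r (extend_system A x I) X \<phi>)"
  by (auto simp: ext_matroid_def transversal_matroid_of_def partial_transversal_iff_matching)

lemma matching_extend_system: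
  assumes "matching r A X \<phi>"
  shows "matching r (extend_system A x I) X \<phi>"
  using assms unfolding matching_def extend_system_def by auto

lemma matching_extend_system_notin:
  assumes "matching r (extend_system A x I) X \<phi>" "x \<notin> X"
  shows "matching r A X \<phi>"
  using assms unfolding matching_def extend_system_def by (auto split: if_splits)

lemma matching_extend_system_insert:
  assumes "matching r A X \<phi>" "i \<in> I" "i \<in> {1..r}" "i \<notin> \<phi> ` X"
  shows "matching r (extend_system A x I) (insert x X) (\<phi>(x := i))"
  by (rule matching_update[OF matching_extend_system[OF assms(1)] assms(3,4)])
    (simp add: extend_system_def assms(2))

text \<open>Trades bases for independent sets without \<open>x\<close>. Such a set extends to a
  basis of the deletion, which contains the coloop \<open>x\<close>; conversely, adding
  \<open>x\<close> to a basis avoiding it would contradict maximality.\<close>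

lemma coloop_delete_iff:
  assumes "finite E" "A k \<subseteq> E" "x \<notin> E"
  shows "coloop (matroid_delete (ext_matroid E r A x I) (A k)) x \<longleftrightarrow>
    (\<forall>X\<subseteq>E - A k. X \<in> indep (ext_matroid E r A x I) \<longrightarrow>
       insert x X \<in> indep (ext_matroid E r A x I))"
    (is "coloop ?N x \<longleftrightarrow> ?R")
proof -
  let ?M = "ext_matroid E r A x I"
  have N: "X \<in> indep ?N \<longleftrightarrow> X \<in> indep ?M \<and> X \<inter> A k = {}" for X
    by (simp add: matroid_delete_def)
  have xg: "x \<in> ground ?N" "x \<notin> A k"
    using assms by (auto simp: matroid_delete_def ext_matroid_def transversal_matroid_of_def)
  have sub: "Y \<in> indep ?M" if "X \<in> indep ?M" "Y \<subseteq> X" for X Y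
    using that matching_subset unfolding indep_ext_matroid by blast
  show ?thesis
  proof
    assume c: "coloop ?N x"
    show ?R
    proof (intro allI impI)
      fix X assume X: "X \<subseteq> E - A k" "X \<in> indep ?M"
      have "finite (indep ?N)"
        by (rule finite_subset[of _ "Pow (insert x E)"]) (use assms(1) in \<open>auto simp: N indep_ext_matroid\<close>)
      moreover have "X \<in> indep ?N"
        using X by (auto simp: N)
      ultimately have "\<exists>B\<in>indep ?N. X \<subseteq> B \<and> (\<forall>Y\<in>indep ?N. B \<subseteq> Y \<longrightarrow> B = Y)"
        by (rule finite_has_maximal2)
      then obtain B where B: "B \<in> indep ?N" "X \<subseteq> B" "\<forall>Y\<in>indep ?N. B \<subseteq> Y \<longrightarrow> Y = B"
        by metis
      then have "x \<in> B"
        using c unfolding coloop_def basis_def by blast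
      with B(2) have "insert x X \<subseteq> B" by blast
      with B(1) show "insert x X \<in> indep ?M"
        using sub N by blast
    qed
  next
    assume R: ?R
    have "x \<in> B" if "basis ?N B" for B
    proof (rule ccontr)
      assume nx: "x \<notin> B"
      have B: "B \<in> indep ?M" "B \<inter> A k = {}" "\<forall>Y\<in>indep ?N. B \<subseteq> Y \<longrightarrow> Y = B"
        using that unfolding basis_def N by auto
      then have "B \<subseteq> E - A k"
        using nx unfolding indep_ext_matroid by blast
      with R B(1) have "insert x B \<in> indep ?M"
        by blast
      then have "insert x B \<in> indep ?N"
        using B(2) xg(2) unfolding N by blast
      with B(3) nx show False by blast
    qed
    with xg show "coloop ?N x"
      unfolding coloop_def by blast
  qed
qed

section \<open>Tight sets and the closure operator\<close>

text \<open>If an index \<open>i\<close> of \<open>I\<close> lay outside the tight set supplied by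
  \<open>tight_of_missed_index\<close>, a matching of \<open>X\<close> missing \<open>i\<close>
  would leave room there for \<open>x\<close>.\<close>

lemma tight_of_insert_dependent:
  assumes "matching r A X \<phi>" "X \<subseteq> E" "k \<in> {1..r}" "k \<notin> \<phi> ` X" "I \<subseteq> {1..r}"
    and "insert x X \<notin> indep (ext_matroid E r A x I)"
  shows "\<exists>C. tight E r A C \<and> I \<subseteq> C \<and> k \<notin> C"
proof -
  obtain C where C: "tight E r A C" "k \<notin> C"
    "\<And>i. i \<in> {1..r} - C \<Longrightarrow> \<exists>\<psi>. matching r A X \<psi> \<and> i \<notin> \<psi> ` X"
    using tight_of_missed_index[OF assms(1-4)] by blast
  have "i \<in> C" if "i \<in> I" for i
  proof (rule ccontr)
    assume "i \<notin> C"
    with that C(3) assms(5) obtain \<psi> where "matching r A X \<psi>" "i \<notin> \<psi> ` X" "i \<in> {1..r}"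
      by blast
    with that have "matching r (extend_system A x I) (insert x X) (\<psi>(x := i))"
      by (intro matching_extend_system_insert)
    with assms(2,6) show False
      unfolding indep_ext_matroid by blast
  qed
  with C show ?thesis by blast
qed

text \<open>The converse direction, by counting: the elements of \<open>insert x X\<close> can only
  be matched to indices in \<open>C\<close>, and there are \<open>card C + 1\<close> of
  them.\<close>

lemma tight_insert_dependent:
  assumes "tight E r A C" "I \<subseteq> C" "\<forall>i\<in>{1..r}. A i \<subseteq> E" "x \<notin> E"
  obtains X \<phi> where "X \<subseteq> E" "matching r A X \<phi>" "\<phi> ` X = C"
    "\<And>i. i \<in> {1..r} - C \<Longrightarrow> X \<inter> A i = {}" "insert x X \<notin> indep (ext_matroid E r A x I)"
proof -
  obtain X \<phi> where C: "C \<subseteq> {1..r}" and X: "X \<subseteq> E"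
      "bij_betw \<phi> X C" "\<forall>e\<in>X. e \<in> A (\<phi> e)" "\<forall>e\<in>X. \<forall>i\<in>{1..r} - C. e \<notin> A i"
    using assms(1) unfolding tight_def by blast
  have "insert x X \<notin> indep (ext_matroid E r A x I)"
  proof
    assume "insert x X \<in> indep (ext_matroid E r A x I)"
    then obtain \<psi> where \<psi>: "matching r (extend_system A x I) (insert x X) \<psi>"
      unfolding indep_ext_matroid by blast
    have xX: "x \<notin> X" using X(1) assms(4) by blast
    have "\<psi> x \<in> {1..r}" "x \<in> extend_system A x I (\<psi> x)"
      using \<psi> unfolding matching_def by auto
    \<comment> \<open>As \<open>x\<close> lies outside \<open>E\<close>, only indices in
      \<open>I\<close> can receive it.\<close>
    then have "\<psi> x \<in> C"
      using assms(2-4) unfolding extend_system_def by (auto split: if_splits)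
    moreover have "matching r A X \<psi>"
      by (rule matching_extend_system_notin[OF matching_subset[OF \<psi>]]) (use xX in auto)
    then have "\<psi> ` X \<subseteq> C"
      using X(4) unfolding matching_def by blast
    ultimately have "\<psi> ` insert x X \<subseteq> C" by blast
    moreover have "finite C" using C by (rule finite_subset) simp
    moreover have "inj_on \<psi> (insert x X)"
      using \<psi> unfolding matching_def by blast
    ultimately have "card (insert x X) \<le> card C"
      by (intro card_inj_on_le)
    moreover have "card X = card C" "finite X"
      using X(2) \<open>finite C\<close> bij_betw_same_card bij_betw_finite by blast+
    ultimately show False using xX by simp
  qed
  moreover have "matching r A X \<phi>" "\<phi> ` X = C"
    using X C unfolding matching_def bij_betw_def by auto
  moreover have "X \<inter> A i = {}" if "i \<in> {1..r} - C" for i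
    using X(4) that by blast
  ultimately show thesis
    using that X(1) by blast
qed

text \<open>Removes matroids from the description of \<open>L_set\<close>: a set \<open>X\<close>
  showing that \<open>x\<close> is no coloop yields, and is yielded by, a tight set that contains
  \<open>I\<close> and omits \<open>k\<close>.\<close>

lemma L_set_iff:
  assumes "finite E" "\<forall>i\<in>{1..r}. A i \<subseteq> E" "x \<notin> E"
  shows "I \<in> L_set E r A x \<longleftrightarrow> I \<subseteq> {1..r} \<and>
    (\<forall>k\<in>{1..r} - I. \<exists>C. tight E r A C \<and> I \<subseteq> C \<and> k \<notin> C)"
proof -
  have "\<not> coloop (matroid_delete (ext_matroid E r A x I) (A k)) x \<longleftrightarrow>
      (\<exists>C. tight E r A C \<and> I \<subseteq> C \<and> k \<notin> C)"
    if I: "I \<subseteq> {1..r}" and k: "k \<in> {1..r} - I" for k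
  proof -
    have Ak: "A k \<subseteq> E" using assms(2) k by blast
    show ?thesis
    proof
      assume "\<not> coloop (matroid_delete (ext_matroid E r A x I) (A k)) x"
      then obtain X where X: "X \<subseteq> E - A k" "X \<in> indep (ext_matroid E r A x I)"
        "insert x X \<notin> indep (ext_matroid E r A x I)"
        unfolding coloop_delete_iff[where A = A and k = k, OF assms(1) Ak assms(3)] by blast
      then obtain \<phi> where "matching r (extend_system A x I) X \<phi>"
        unfolding indep_ext_matroid by blast
      then have \<phi>: "matching r A X \<phi>"
        by (rule matching_extend_system_notin) (use X(1) assms(3) in blast)
      \<comment> \<open>An element matched to \<open>k\<close> would lie in \<open>A k\<close>,
        which \<open>X\<close> avoids.\<close>
      then have "k \<notin> \<phi> ` X"
        using X(1) unfolding matching_def by blast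
      with \<phi> X I k assms(3) show "\<exists>C. tight E r A C \<and> I \<subseteq> C \<and> k \<notin> C"
        by (intro tight_of_insert_dependent[of r A X \<phi> E k I x]) auto
    next
      assume "\<exists>C. tight E r A C \<and> I \<subseteq> C \<and> k \<notin> C"
      then obtain C where C: "tight E r A C" "I \<subseteq> C" "k \<notin> C"
        by blast
      obtain X \<phi> where X: "X \<subseteq> E" "matching r A X \<phi>"
          "\<And>i. i \<in> {1..r} - C \<Longrightarrow> X \<inter> A i = {}" "insert x X \<notin> indep (ext_matroid E r A x I)"
        using tight_insert_dependent[OF C(1,2) assms(2,3)] by metis
      have "X \<in> indep (ext_matroid E r A x I)"
        unfolding indep_ext_matroid using X(1) matching_extend_system[OF X(2)] by blast
      moreover have "X \<subseteq> E - A k"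
        using X(1) X(3)[of k] C(3) k by blast
      ultimately show "\<not> coloop (matroid_delete (ext_matroid E r A x I) (A k)) x"
        using X(4) unfolding coloop_delete_iff[where A = A and k = k, OF assms(1) Ak assms(3)] by blast
    qed
  qed
  then show ?thesis
    unfolding L_set_def sigma_op_def by blast
qed

section \<open>Closed sets of indices and the weak order\<close>

text \<open>Tight sets omitting \<open>k\<close>, one over \<open>I\<close> and one over
  \<open>J\<close>, have a tight union that still omits \<open>k\<close>.\<close>

lemma L_set_Un:
  assumes "finite E" "\<forall>i\<in>{1..r}. A i \<subseteq> E" "x \<notin> E"
    and "I \<in> L_set E r A x" "J \<in> L_set E r A x"
  shows "I \<union> J \<in> L_set E r A x"
  unfolding L_set_iff[where A = A, OF assms(1-3)]
proof (intro conjI ballI)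
  note IJ = assms(4,5)[unfolded L_set_iff[where A = A, OF assms(1-3)]]
  show "I \<union> J \<subseteq> {1..r}" using IJ by blast
  fix k assume "k \<in> {1..r} - (I \<union> J)"
  with IJ obtain C D where "tight E r A C" "I \<subseteq> C" "k \<notin> C" "tight E r A D" "J \<subseteq> D" "k \<notin> D"
    by (metis DiffE DiffI UnCI)
  with tight_Un show "\<exists>C. tight E r A C \<and> I \<union> J \<subseteq> C \<and> k \<notin> C"
    by (metis Un_iff Un_mono)
qed

text \<open>An index outside \<open>I \<inter> J\<close> is outside \<open>I\<close> or
  \<open>J\<close>, and a tight set for that one also contains the intersection.\<close>

lemma L_set_Int:
  assumes "finite E" "\<forall>i\<in>{1..r}. A i \<subseteq> E" "x \<notin> E"
    and "I \<in> L_set E r A x" "J \<in> L_set E r A x"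
  shows "I \<inter> J \<in> L_set E r A x"
  using assms(4,5) unfolding L_set_iff[where A = A, OF assms(1-3)]
  by (meson Diff_iff Int_iff le_infI1 le_infI2)

lemma ext_matroid_mono:
  assumes "I \<subseteq> J"
  shows "weak_le (ext_matroid E r A x I) (ext_matroid E r A x J)"
proof -
  have "matching r (extend_system A x J) X \<phi>" if "matching r (extend_system A x I) X \<phi>" for X \<phi>
    using that assms unfolding matching_def extend_system_def by (auto split: if_splits)
  then have "indep (ext_matroid E r A x I) \<subseteq> indep (ext_matroid E r A x J)"
    unfolding indep_ext_matroid subset_iff by blast
  then show ?thesis
    by (simp add: weak_le_def ext_matroid_def transversal_matroid_of_def)
qed

text \<open>For \<open>k\<close> in \<open>I - J\<close>, take a tight \<open>C\<close> that
  contains \<open>J\<close> and omits \<open>k\<close>. Its witness \<open>X\<close> together with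
  \<open>x\<close> is dependent for \<open>J\<close>, but for \<open>I\<close> the element
  \<open>x\<close> can take the free index \<open>k\<close>.\<close>

lemma weak_le_ext_matroid_iff:
  assumes "finite E" "\<forall>i\<in>{1..r}. A i \<subseteq> E" "x \<notin> E"
    and "I \<in> L_set E r A x" "J \<in> L_set E r A x"
  shows "weak_le (ext_matroid E r A x I) (ext_matroid E r A x J) \<longleftrightarrow> I \<subseteq> J"
proof
  assume w: "weak_le (ext_matroid E r A x I) (ext_matroid E r A x J)"
  show "I \<subseteq> J"
  proof
    fix k assume k: "k \<in> I"
    show "k \<in> J"
    proof (rule ccontr)
      assume nk: "k \<notin> J"
      have kr: "k \<in> {1..r}" using assms(4) k unfolding L_set_def by blast
      with nk assms(5) obtain C where C: "tight E r A C" "J \<subseteq> C" "k \<notin> C"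
        unfolding L_set_iff[where A = A, OF assms(1-3)] by blast
      obtain X \<phi> where X: "X \<subseteq> E" "matching r A X \<phi>" "\<phi> ` X = C"
          "insert x X \<notin> indep (ext_matroid E r A x J)"
        using tight_insert_dependent[OF C(1,2) assms(2,3)] by metis
      have "matching r (extend_system A x I) (insert x X) (\<phi>(x := k))"
        using matching_extend_system_insert X(2,3) k kr C(3) by metis
      then have "insert x X \<in> indep (ext_matroid E r A x I)"
        using X(1) unfolding indep_ext_matroid by blast
      with w X(4) show False
        unfolding weak_le_def by blast
    qed
  qed
qed (rule ext_matroid_mono)

section \<open>Rings of sets as lattices\<close>

text \<open>Stated for an image so as to serve twice: \<open>h = id\<close> gives
  \<open>L_order\<close>, and the extension map gives \<open>T_order\<close>. Antisymmetry holds
  because the order reflects inclusion.\<close>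

lemma lattice_image_ring_of_sets:
  fixes K :: "'b gorder" and h :: "'c set \<Rightarrow> 'b"
  assumes carr: "carrier K = h ` S" and eq: "eq K = (=)"
    and le: "\<And>I J. I \<in> S \<Longrightarrow> J \<in> S \<Longrightarrow> le K (h I) (h J) \<longleftrightarrow> I \<subseteq> J"
    and Un: "\<And>I J. I \<in> S \<Longrightarrow> J \<in> S \<Longrightarrow> I \<union> J \<in> S"
    and Int: "\<And>I J. I \<in> S \<Longrightarrow> J \<in> S \<Longrightarrow> I \<inter> J \<in> S"
  shows "lattice K"
    and "\<And>I J. I \<in> S \<Longrightarrow> J \<in> S \<Longrightarrow> h I \<squnion>\<^bsub>K\<^esub> h J = h (I \<union> J)"
    and "\<And>I J. I \<in> S \<Longrightarrow> J \<in> S \<Longrightarrow> h I \<sqinter>\<^bsub>K\<^esub> h J = h (I \<inter> J)"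
proof -
  interpret partial_order K
    by unfold_locales (auto simp: carr eq le)
  have lub: "least K (h (I \<union> J)) (Upper K {h I, h J})" if "I \<in> S" "J \<in> S" for I J
    using that Un[OF that] unfolding least_def Upper_def carr by (auto simp: le)
  have glb: "greatest K (h (I \<inter> J)) (Lower K {h I, h J})" if "I \<in> S" "J \<in> S" for I J
    using that Int[OF that] unfolding greatest_def Lower_def carr by (auto simp: le)
  show "lattice K"
  proof
    fix a b assume "a \<in> carrier K" "b \<in> carrier K"
    then obtain I J where "I \<in> S" "J \<in> S" "a = h I" "b = h J"
      unfolding carr by blast
    with lub glb show "\<exists>s. least K s (Upper K {a, b})" "\<exists>s. greatest K s (Lower K {a, b})"
      by metis+
  qed
  show "h I \<squnion>\<^bsub>K\<^esub> h J = h (I \<union> J)" if "I \<in> S" "J \<in> S" for I J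
    \<comment> \<open>\<open>sup\<close> is a choice among least upper bounds, so their uniqueness
      identifies it.\<close>
    unfolding join_def sup_def
    by (rule some_equality, rule lub[OF that]) (rule least_unique[OF _ lub[OF that]])
  show "h I \<sqinter>\<^bsub>K\<^esub> h J = h (I \<inter> J)" if "I \<in> S" "J \<in> S" for I J
    unfolding meet_def inf_def
    by (rule some_equality, rule glb[OF that]) (rule greatest_unique[OF _ glb[OF that]])
qed

theorem theorem3p4:
  fixes M :: "'a matroid" and A :: "nat \<Rightarrow> 'a set" and r :: nat and x :: 'a
  assumes "is_transversal M"
    and "matroid_rank M = r"
    and "is_presentation r A M"
    and "x \<notin> ground M"
  shows "(\<forall>I\<in>L_set (ground M) r A x. \<forall>J\<in>L_set (ground M) r A x.
            weak_le (ext_matroid (ground M) r A x I) (ext_matroid (ground M) r A x J)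
              \<longleftrightarrow> I \<subseteq> J)
       \<and> lattice_iso (L_order (ground M) r A x) (T_order (ground M) r A x)
            (ext_matroid (ground M) r A x)
       \<and> distributive_lattice (T_order (ground M) r A x)"
proof -
  let ?E = "ground M"
  let ?S = "L_set ?E r A x"
  let ?L = "L_order ?E r A x"
  let ?T = "T_order ?E r A x"
  let ?h = "ext_matroid ?E r A x"
  have E: "finite ?E" "\<forall>i\<in>{1..r}. A i \<subseteq> ?E" "x \<notin> ?E"
    using assms by (auto simp: is_transversal_def is_matroid_def is_presentation_def)
  note closed = L_set_Un[where A = A, OF E] L_set_Int[where A = A, OF E]
  note iff = weak_le_ext_matroid_iff[where A = A, OF E]
  have L: "carrier ?L = id ` ?S" "eq ?L = (=)"
      "\<And>I J. I \<in> ?S \<Longrightarrow> J \<in> ?S \<Longrightarrow> le ?L (id I) (id J) \<longleftrightarrow> I \<subseteq> J"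
    by (simp_all add: L_order_def)
  have T: "carrier ?T = ?h ` ?S" "eq ?T = (=)"
      "\<And>I J. I \<in> ?S \<Longrightarrow> J \<in> ?S \<Longrightarrow> le ?T (?h I) (?h J) \<longleftrightarrow> I \<subseteq> J"
    using iff by (simp_all add: T_order_def T_set_def)
  note latL = lattice_image_ring_of_sets[where h = id, OF L closed, simplified]
  note latT = lattice_image_ring_of_sets[where h = ?h, OF T closed]
  \<comment> \<open>Equal matroids are weakly below each other, which gives both inclusions.\<close>
  have "inj_on ?h ?S"
  proof (rule inj_onI)
    fix I J assume "I \<in> ?S" "J \<in> ?S" "?h I = ?h J"
    with iff[of I J] iff[of J I] show "I = J"
      by (simp add: weak_le_def)
  qed
  then have "bij_betw ?h (carrier ?L) (carrier ?T)"
    by (simp add: bij_betw_def L(1) T(1))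
  then have "lattice_iso ?L ?T ?h"
    using latL latT L(1) unfolding lattice_iso_def by simp
  \<comment> \<open>Joins and meets in \<open>?T\<close> are images of unions and intersections, so
    the law is inherited from sets.\<close>
  moreover have "distributive_lattice ?T"
    using latT(1) closed unfolding distributive_lattice_def T(1)
    by (simp add: latT Int_Un_distrib)
  ultimately show ?thesis
    using iff by blast
qed

end
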